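(* In each of the following cases there exists a constant $C\in\mathbb{R}$, independent of $\theta$, such that for every $\theta$ in the domain with $R_\theta^{(2)}(\theta)\neq 0$, $$\frac{R^{(3)}_{\theta}(\theta)}{R^{(2)}_{\theta}(\theta)}=\frac{C}{\theta}.$$ (A) Surrogate reward functions $R_\theta(\hat\theta)$ of one of the following forms, where $f,g,h$ are arbitrary real-valued functions of $\theta$: 1. $R_\theta(\hat\theta)=f(\theta)\sum_{i=1}^I a_i\,\theta^{j_i}\hat\theta^{K-j_i}+g(\theta)\hat\theta+h(\theta)$, with $I,K\in\mathbb{Z}_+$, $a_i\in\mathbb{R}$, $j_i\in\mathbb{R}$ constants; 2. $R_\theta(\hat\theta)=f(\theta)\exp\left(\frac{a\hat\theta}{\theta}\right)$ or $R_\theta(\hat\theta)=\frac{f(\theta)}{\hat\theta}\exp\left(\frac{a\theta}{\hat\theta}\right)$, with $a\in\mathbb{R}$ a constant; 3. $R_\theta(\hat\theta)=f(\theta)\log\left(g(\theta)\hat\theta\right)+\hat\theta$, for $g(\theta)\hat\theta>0$. (B) Surrogate reward functions $R_\theta(\hat\theta)=F(z(\hat\theta),\theta)$, where $z(\hat\theta)$ is derived from the first-order condition $\partial_z F(z,\hat\theta)=0$ and $F$ is one of the following objective functions: 1. $F(z,\theta)=a_1\theta\log(z)-a_2 z$, with $a_1\theta>0$, $a_2>0$; 2. $F(z,\theta)=f(a,\theta,\gamma)\,z\,(a-\theta z)^{\gamma}$, with $\theta>0$ and known constants $\gamma>0$, $a>0$, where $f(a,\theta,\gamma)$ is any function independent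 of $z$; 3. $F(z,\theta)=f(a,\theta)\,z\exp(a-\theta z)$, with $a>0$, $\theta>0$, where $f(a,\theta)$ is any function independent of $z$.
   Context: A decision-maker maximizes a reward $F(z,\theta)$ over decisions $z$, where $\theta$ is a scalar parameter (nonzero). The decision computed from a parameter value $\hat\theta$ is $z(\hat\theta)$, and the surrogate reward is $R_\theta(\hat\theta)=F(z(\hat\theta),\theta)$. $R_\theta^{(k)}(x)$ denotes the $k$-th derivative of $x\mapsto R_\theta(x)$ with respect to its argument ($\theta$ in the subscript held fixed), and $R_\theta^{(k)}(\theta)$ is its value at $x=\theta$. The parameters $\theta,\hat\theta$ range over a domain on which the displayed expressions are well defined. "Constant independent of $\theta$" means $C$ may depend on the fixed constants ($a_i$, $j_i$, $I$, $K$, $a$, $a_1$, $a_2$, $\gamma$) but not on $\theta$. In case (B)2 the first-order condition is taken with nonzero demand, $a-\hat\theta z>0$, so that $z(\hat\theta)=a/(\hat\theta(1+\gamma))$. *)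

theory Defs
  imports "HOL-Analysis.Analysis"
begin

text \<open>
  The conventional real power \<open>x\<^sup>p\<close> with a real exponent: for negative \<open>x\<close> it is meaningful only
  for integer \<open>p\<close>. Plain \<^const>\<open>powr\<close> cannot be used there, since \<open>x powr p\<close> is not the usual
  power when \<open>x < 0\<close>. For \<open>x > 0\<close> both branches agree with \<^const>\<open>powr\<close>.
\<close>
definition rpow :: "real \<Rightarrow> real \<Rightarrow> real" where
  "rpow x p = (if p \<in> \<int> then x powi \<lfloor>p\<rfloor> else x powr p)"

text \<open>\<open>R \<theta>\<close> is the function \<open>x \<mapsto> R\<^sub>\<theta>(x)\<close>, which is differentiated with \<open>\<theta>\<close> held fixed.\<close>
definition derivative_ratio_on :: "real set \<Rightarrow> (real \<Rightarrow> real \<Rightarrow> real) \<Rightarrow> real \<Rightarrow> bool" where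
  "derivative_ratio_on D R C \<longleftrightarrow>
     (\<forall>\<theta>\<in>D. (deriv ^^ 2) (R \<theta>) \<theta> \<noteq> 0 \<longrightarrow>
        (deriv ^^ 3) (R \<theta>) \<theta> / (deriv ^^ 2) (R \<theta>) \<theta> = C / \<theta>)"

text \<open>
  \<open>z\<close> is the decision rule determined on \<open>D\<close> by the first-order condition \<open>\<partial>\<^sub>z F(z,x) = 0\<close>, where
  \<open>Z x\<close> is the set of admissible decisions for the parameter value \<open>x\<close>. Uniqueness is part of
  the definition because otherwise the condition does not define \<open>z x\<close>: if \<open>F(\<cdot>,x)\<close>
  vanishes identically, every decision satisfies it.
\<close>
definition foc_decision ::
    "(real \<Rightarrow> real \<Rightarrow> real) \<Rightarrow> (real \<Rightarrow> real set) \<Rightarrow> real set \<Rightarrow> (real \<Rightarrow> real) \<Rightarrow> bool" where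
  "foc_decision F Z D z \<longleftrightarrow>
     (\<forall>x\<in>D. z x \<in> Z x \<and>
        (\<forall>w\<in>Z x. ((\<lambda>v. F v x) has_real_derivative 0) (at w) \<longleftrightarrow> w = z x))"

definition surrogate :: "(real \<Rightarrow> real \<Rightarrow> real) \<Rightarrow> (real \<Rightarrow> real) \<Rightarrow> real \<Rightarrow> real \<Rightarrow> real" where
  "surrogate F z \<theta> x = F (z x) \<theta>"

end

theory Submission
  imports Defs
begin

text \<open>
  In every case the surrogate reward depends on \<open>x\<close> only through the ratio \<open>x / \<theta>\<close>, up to an affine
  term: near \<open>\<theta>\<close> one has \<open>R\<^sub>\<theta>(x) = c(\<theta>) \<phi>(x / \<theta>) + g(\<theta>) x + h(\<theta>)\<close> with a smooth function \<open>\<phi>\<close> that does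
  not depend on \<open>\<theta>\<close>. Hence \<open>R\<^sub>\<theta>''(\<theta>) = c(\<theta>) \<phi>''(1) / \<theta>\<^sup>2\<close> and \<open>R\<^sub>\<theta>'''(\<theta>) = c(\<theta>) \<phi>'''(1) / \<theta>\<^sup>3\<close>, so the
  constant is \<open>C = \<phi>'''(1) / \<phi>''(1)\<close>.
\<close>

section \<open>Repeated differentiability on a set and its closure rules\<close>

text \<open>The derivatives are hidden behind existential quantifiers, so the closure rules go by
  induction on the order and no third derivative is ever written out.\<close>

fun times_differentiable_on :: "nat \<Rightarrow> real set \<Rightarrow> (real \<Rightarrow> real) \<Rightarrow> bool" where
  "times_differentiable_on 0 S f \<longleftrightarrow> True"
| "times_differentiable_on (Suc n) S f \<longleftrightarrow>
     (\<exists>f'. (\<forall>x\<in>S. (f has_real_derivative f' x) (at x)) \<and> times_differentiable_on n S f')"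

lemma times_differentiable_on_SucI:
  assumes "\<And>x. x \<in> S \<Longrightarrow> (f has_real_derivative f' x) (at x)" "times_differentiable_on n S f'"
  shows "times_differentiable_on (Suc n) S f"
  using assms by auto

lemma times_differentiable_on_SucE:
  assumes "times_differentiable_on (Suc n) S f"
  obtains f' where "\<And>x. x \<in> S \<Longrightarrow> (f has_real_derivative f' x) (at x)"
    "times_differentiable_on n S f'"
  using assms by auto

lemma times_differentiable_on_Suc_imp:
  "times_differentiable_on (Suc n) S f \<Longrightarrow> times_differentiable_on n S f"
proof (induction n arbitrary: f)
  case (Suc n)
  then obtain f' where "\<forall>x\<in>S. (f has_real_derivative f' x) (at x)"
    "times_differentiable_on (Suc n) S f'"
    by auto
  with Suc.IH show ?case by auto
qed simp

lemma times_differentiable_on_const: "times_differentiable_on n S (\<lambda>x. c)"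
proof (induction n arbitrary: c)
  case (Suc n)
  show ?case by (rule times_differentiable_on_SucI[OF _ Suc.IH[of 0]]) simp
qed simp

lemma times_differentiable_on_ident: "times_differentiable_on n S (\<lambda>x. x)"
proof (cases n)
  case (Suc m)
  show ?thesis unfolding Suc
    by (rule times_differentiable_on_SucI[OF _ times_differentiable_on_const[of m S 1]]) simp
qed simp

lemma times_differentiable_on_add:
  "times_differentiable_on n S f \<Longrightarrow> times_differentiable_on n S g \<Longrightarrow>
    times_differentiable_on n S (\<lambda>x. f x + g x)"
proof (induction n arbitrary: f g)
  case (Suc n)
  from Suc.prems(1) obtain f' where f:
    "\<And>x. x \<in> S \<Longrightarrow> (f has_real_derivative f' x) (at x)" "times_differentiable_on n S f'"
    by (rule times_differentiable_on_SucE) (rule that)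
  from Suc.prems(2) obtain g' where g:
    "\<And>x. x \<in> S \<Longrightarrow> (g has_real_derivative g' x) (at x)" "times_differentiable_on n S g'"
    by (rule times_differentiable_on_SucE) (rule that)
  from f g show ?case
    by (intro times_differentiable_on_SucI[where f' = "\<lambda>x. f' x + g' x"] Suc.IH DERIV_add)
qed simp

lemma times_differentiable_on_mult:
  "times_differentiable_on n S f \<Longrightarrow> times_differentiable_on n S g \<Longrightarrow>
    times_differentiable_on n S (\<lambda>x. f x * g x)"
proof (induction n arbitrary: f g)
  case (Suc n)
  from Suc.prems(1) obtain f' where f:
    "\<And>x. x \<in> S \<Longrightarrow> (f has_real_derivative f' x) (at x)" "times_differentiable_on n S f'"
    by (rule times_differentiable_on_SucE) (rule that)
  from Suc.prems(2) obtain g' where g: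
    "\<And>x. x \<in> S \<Longrightarrow> (g has_real_derivative g' x) (at x)" "times_differentiable_on n S g'"
    by (rule times_differentiable_on_SucE) (rule that)
  \<comment> \<open>The product rule brings back \<open>f\<close> and \<open>g\<close> themselves;
    they are known to order \<open>Suc n\<close> and are lowered by one to fit the induction
    hypothesis.\<close>
  have "times_differentiable_on n S (\<lambda>x. f' x * g x + g' x * f x)"
    using f g Suc.prems[THEN times_differentiable_on_Suc_imp]
    by (intro times_differentiable_on_add Suc.IH)
  then show ?case
    by (rule times_differentiable_on_SucI[rotated]) (intro DERIV_mult f g)
qed simp

lemma times_differentiable_on_sum:
  assumes "\<And>i. i \<in> A \<Longrightarrow> times_differentiable_on n S (f i)"
  shows "times_differentiable_on n S (\<lambda>x. \<Sum>i\<in>A. f i x)"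
  using assms
proof (induction A rule: infinite_finite_induct)
  case (insert i A)
  then show ?case by (simp add: times_differentiable_on_add)
qed (simp_all add: times_differentiable_on_const)

lemma times_differentiable_on_compose:
  "times_differentiable_on n T f \<Longrightarrow> times_differentiable_on n S g \<Longrightarrow> g ` S \<subseteq> T \<Longrightarrow>
    times_differentiable_on n S (\<lambda>x. f (g x))"
proof (induction n arbitrary: f)
  case (Suc n)
  from Suc.prems(1) obtain f' where f:
    "\<And>x. x \<in> T \<Longrightarrow> (f has_real_derivative f' x) (at x)" "times_differentiable_on n T f'"
    by (rule times_differentiable_on_SucE) (rule that)
  from Suc.prems(2) obtain g' where g:
    "\<And>x. x \<in> S \<Longrightarrow> (g has_real_derivative g' x) (at x)" "times_differentiable_on n S g'"
    by (rule times_differentiable_on_SucE) (rule that)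
  \<comment> \<open>The inner function \<open>g\<close> stays fixed in the induction: only
    \<open>f\<close> is replaced by \<open>f'\<close>, and the chain rule factor \<open>g'\<close>
    is handled by the product rule.\<close>
  have "times_differentiable_on n S (\<lambda>x. f' (g x) * g' x)"
    using times_differentiable_on_mult[OF Suc.IH[OF f(2) times_differentiable_on_Suc_imp] g(2)]
      Suc.prems(2,3) by blast
  moreover have "((\<lambda>x. f (g x)) has_real_derivative f' (g x) * g' x) (at x)" if "x \<in> S" for x
    using DERIV_chain2[of f "f' (g x)" g x "g' x"] f g that Suc.prems(3) by auto
  ultimately show ?case by (rule times_differentiable_on_SucI[rotated])
qed simp

lemma times_differentiable_on_exp: "times_differentiable_on n S exp"
proof (induction n)
  case (Suc n)
  show ?case by (rule times_differentiable_on_SucI[OF DERIV_exp Suc.IH])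
qed simp

lemma times_differentiable_on_powr: "times_differentiable_on n {0<..} (\<lambda>x. x powr p)"
proof (induction n arbitrary: p)
  case (Suc n)
  have "times_differentiable_on n {0<..} (\<lambda>x. p * x powr (p - 1))"
    by (intro times_differentiable_on_mult times_differentiable_on_const Suc.IH)
  then show ?case
    by (rule times_differentiable_on_SucI[rotated]) (auto intro: has_real_derivative_powr)
qed simp

lemma times_differentiable_on_inverse: "times_differentiable_on n {0<..} inverse"
proof (induction n)
  case (Suc n)
  \<comment> \<open>The derivative of \<open>inverse\<close> is written as a product of copies of
    \<open>inverse\<close>, so that the induction hypothesis applies to it.\<close>
  have "times_differentiable_on n {0<..} (\<lambda>x. - 1 * (inverse x * inverse x))"
    by (intro times_differentiable_on_mult times_differentiable_on_const Suc.IH)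
  then show ?case
    by (rule times_differentiable_on_SucI[rotated])
      (auto intro!: derivative_eq_intros simp: power2_eq_square)
qed simp

lemma times_differentiable_on_ln: "times_differentiable_on n {0<..} ln"
proof (cases n)
  case (Suc m)
  show ?thesis unfolding Suc
    by (rule times_differentiable_on_SucI[OF _ times_differentiable_on_inverse])
      (auto intro!: derivative_eq_intros simp: divide_inverse)
qed simp

section \<open>Higher derivatives of functions of the ratio \<open>x / \<theta>\<close>\<close>

text \<open>Since \<open>T\<close> is open, an equality on \<open>T\<close> holds near each of its
  points and therefore survives another \<open>deriv\<close>. This turns a chain of witnesses
  \<open>F k\<close> into iterated derivatives.\<close>

lemma higher_deriv_eqI:
  fixes f :: "real \<Rightarrow> real"
  assumes "open T"
    and "\<And>x. x \<in> T \<Longrightarrow> f x = F 0 x"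
    and "\<And>k x. k < n \<Longrightarrow> x \<in> T \<Longrightarrow> (F k has_real_derivative F (Suc k) x) (at x)"
  shows "k \<le> n \<Longrightarrow> x \<in> T \<Longrightarrow> (deriv ^^ k) f x = F k x"
proof (induction k arbitrary: x)
  case (Suc k)
  have "\<forall>\<^sub>F y in nhds x. (deriv ^^ k) f y = F k y"
    using eventually_nhds_in_open[OF assms(1) Suc.prems(2)]
    by eventually_elim (use Suc in auto)
  then have "deriv ((deriv ^^ k) f) x = deriv (F k) x"
    by (rule deriv_cong_ev) simp
  also have "\<dots> = F (Suc k) x"
    using assms(3) Suc.prems by (intro DERIV_imp_deriv) auto
  finally show ?case by simp
qed (simp add: assms)

text \<open>This is the constant of the theorem. It depends on \<phi> alone, which is what makes it
  independent of \<theta> and of the arbitrary coefficient functions. If the denominator is 0, so is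
  the second derivative of the reward, and nothing is claimed.\<close>

definition ratio_at_1 :: "(real \<Rightarrow> real) \<Rightarrow> real" where
  "ratio_at_1 \<phi> = (deriv ^^ 3) \<phi> 1 / (deriv ^^ 2) \<phi> 1"

text \<open>The common reduction for all cases. Derivatives at \<theta> see only a neighbourhood, so
  the representation of \<open>R\<close> may be local to \<open>U \<theta>\<close>, and \<phi> has
  to be smooth only near \<open>1 = \<theta> / \<theta>\<close>.\<close>

lemma derivative_ratio_onI:
  assumes S: "open S" "1 \<in> S"
    and \<phi>: "times_differentiable_on 3 S \<phi>"
    and D: "\<And>\<theta>. \<theta> \<in> D \<Longrightarrow> \<theta> \<noteq> 0 \<and> open (U \<theta>) \<and> \<theta> \<in> U \<theta>"
    and R: "\<And>\<theta> x. \<theta> \<in> D \<Longrightarrow> x \<in> U \<theta> \<Longrightarrow> R \<theta> x = c \<theta> * \<phi> (x / \<theta>) + g \<theta> * x + h \<theta>"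
  shows "derivative_ratio_on D R (ratio_at_1 \<phi>)"
  unfolding derivative_ratio_on_def
proof (intro ballI impI)
  fix \<theta> assume "\<theta> \<in> D" and R2: "(deriv ^^ 2) (R \<theta>) \<theta> \<noteq> 0"
  have U: "\<theta> \<noteq> 0" "open (U \<theta>)" "\<theta> \<in> U \<theta>"
    using D[OF \<open>\<theta> \<in> D\<close>] by auto
  from \<phi>[unfolded numeral_3_eq_3] obtain \<phi>1 where
    d1: "\<And>x. x \<in> S \<Longrightarrow> (\<phi> has_real_derivative \<phi>1 x) (at x)"
    and s1: "times_differentiable_on (Suc (Suc 0)) S \<phi>1"
    by (rule times_differentiable_on_SucE) (rule that)
  from s1 obtain \<phi>2 where d2: "\<And>x. x \<in> S \<Longrightarrow> (\<phi>1 has_real_derivative \<phi>2 x) (at x)"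
    and s2: "times_differentiable_on (Suc 0) S \<phi>2"
    by (rule times_differentiable_on_SucE) (rule that)
  from s2 obtain \<phi>3 where d3: "\<And>x. x \<in> S \<Longrightarrow> (\<phi>2 has_real_derivative \<phi>3 x) (at x)"
    and s3: "times_differentiable_on 0 S \<phi>3"
    by (rule times_differentiable_on_SucE) (rule that)
  \<comment> \<open>\<open>P k\<close> and \<open>A k\<close> are the derivatives of order
    \<open>k\<close> of \<phi> and of the affine term, and \<open>F k\<close> is that of the whole
    representation: each chain rule step contributes one factor \<open>1 / \<theta>\<close>.\<close>
  define P where "P = (!) [\<phi>, \<phi>1, \<phi>2, \<phi>3]"
  define A where "A = (!) [\<lambda>x. g \<theta> * x + h \<theta>, \<lambda>x. g \<theta>, \<lambda>x. 0, \<lambda>x. 0]"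
  define F where "F k x = c \<theta> / \<theta> ^ k * P k (x / \<theta>) + A k x" for k x
  \<comment> \<open>Here the representation holds and the ratio stays where \<phi> is
    differentiable.\<close>
  define T where "T = U \<theta> \<inter> (\<lambda>x. x / \<theta>) -` S"
  have less_3: "k < 3 \<Longrightarrow> k = 0 \<or> k = 1 \<or> k = 2" for k :: nat by auto
  have dP: "(P k has_real_derivative P (Suc k) x) (at x)" if "k < 3" "x \<in> S" for k x
    using less_3[OF that(1)] d1 d2 d3 that(2) by (auto simp: P_def numeral_2_eq_2)
  have dA: "(A k has_real_derivative A (Suc k) x) (at x)" if "k < 3" for k x
    using less_3[OF that] by (auto simp: A_def numeral_2_eq_2 intro!: derivative_eq_intros)
  have "(F k has_real_derivative F (Suc k) x) (at x)" if "k < 3" "x \<in> T" for k x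
  proof -
    have "((\<lambda>x. P k (x / \<theta>)) has_real_derivative P (Suc k) (x / \<theta>) * (1 / \<theta>)) (at x)"
      using that by (intro DERIV_chain2[OF dP] DERIV_cdivide DERIV_ident) (auto simp: T_def)
    from DERIV_add[OF DERIV_cmult[OF this, of "c \<theta> / \<theta> ^ k"] dA[OF that(1), of x]]
    show ?thesis by (simp add: F_def[abs_def] field_simps)
  qed
  moreover have "open T"
    unfolding T_def using U S by (intro open_Int open_vimage continuous_intros) auto
  moreover have "R \<theta> x = F 0 x" if "x \<in> T" for x
    using that R[OF \<open>\<theta> \<in> D\<close>] by (simp add: T_def F_def P_def A_def)
  moreover have "\<theta> \<in> T"
    using U S by (simp add: T_def)
  ultimately have RF: "(deriv ^^ k) (R \<theta>) \<theta> = F k \<theta>" if "k \<le> 3" for k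
    using higher_deriv_eqI[of T "R \<theta>" F 3 k \<theta>] that by blast
  have \<phi>P: "(deriv ^^ k) \<phi> 1 = P k 1" if "k \<le> 3" for k
    using higher_deriv_eqI[OF S(1), of \<phi> P 3 k 1] dP that S(2) by (simp add: P_def)
  \<comment> \<open>The affine term is gone at order 2, so \<open>R2\<close> says that a product
    with these two factors is nonzero; both can then be cancelled in the quotient.\<close>
  have "P 2 1 \<noteq> 0" "c \<theta> \<noteq> 0"
    using R2 RF[of 2] U by (auto simp: F_def A_def)
  then show "(deriv ^^ 3) (R \<theta>) \<theta> / (deriv ^^ 2) (R \<theta>) \<theta> = ratio_at_1 \<phi> / \<theta>"
    using U by (simp add: ratio_at_1_def RF \<phi>P F_def A_def field_simps power2_eq_square power3_eq_cube)
qed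

section \<open>Real powers of a ratio, and identification of the decision\<close>

text \<open>Substitute \<open>x = \<theta> * (x / \<theta>)\<close> and collect the powers of
  \<theta>. As \<open>x\<close> has the sign of \<theta>, the ratio is positive and plain
  \<open>powr\<close> is the right power for it, even when \<theta> is negative.\<close>

lemma rpow_mult_rpow_diff:
  assumes "\<theta> > 0 \<or> (\<theta> \<noteq> 0 \<and> j \<in> \<int>)" "x / \<theta> > 0"
  shows "rpow \<theta> j * rpow x (real K - j) = \<theta> ^ K * (x / \<theta>) powr (real K - j)"
proof (cases "j \<in> \<int>")
  case True
  then obtain m where m: "j = of_int m" by (auto elim: Ints_cases)
  have "x \<noteq> 0" "\<theta> \<noteq> 0" using assms(2) by auto
  \<comment> \<open>Both exponents are integers, so everything becomes an integer power and negative
    bases are harmless.\<close>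
  have "real K - j = of_int (int K - m)" by (simp add: m)
  then have r: "rpow \<theta> j = \<theta> powi m" "rpow x (real K - j) = x powi (int K - m)"
    "(x / \<theta>) powr (real K - j) = (x / \<theta>) powi (int K - m)"
    using assms(2) powr_real_of_int'[OF less_imp_le[OF assms(2)], of "int K - m"]
      \<open>x \<noteq> 0\<close> \<open>\<theta> \<noteq> 0\<close> by (auto simp: rpow_def m)
  have "\<theta> ^ K = \<theta> powi m * \<theta> powi (int K - m)"
    using \<open>\<theta> \<noteq> 0\<close> by (simp flip: power_int_add)
  then show ?thesis
    using \<open>\<theta> \<noteq> 0\<close> by (simp add: r power_int_divide_distrib)
next
  case False
  \<comment> \<open>A non-integer \<open>j\<close> leaves only positive \<theta>;
    \<open>real K - j\<close> is then also no integer, so both \<open>rpow\<close> factors are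
    \<open>powr\<close>.\<close>
  then have "\<theta> > 0" "x > 0" using assms by (auto simp: zero_less_divide_iff)
  moreover have "real K - j \<notin> \<int>"
    using False Ints_diff[of "real K" "real K - j"] by auto
  moreover have "\<theta> ^ K = \<theta> powr j * \<theta> powr (real K - j)"
    using \<open>\<theta> > 0\<close> by (simp add: powr_realpow flip: powr_add)
  ultimately show ?thesis
    using False by (simp add: rpow_def powr_divide)
qed

text \<open>Uniqueness is built into \<open>foc_decision\<close>, so a guessed admissible critical
  point only has to be checked.\<close>

lemma foc_decision_eq:
  assumes "foc_decision F Z D z" "x \<in> D" "w \<in> Z x"
    and "((\<lambda>v. F v x) has_real_derivative 0) (at w)"
  shows "z x = w"
  using assms by (auto simp: foc_decision_def)

section \<open>Explicit surrogate rewards\<close>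

text \<open>On the half-line of points with the sign of \<theta>, every summand is
  \<open>\<theta> ^ K\<close> times a power of the ratio, and \<open>\<theta> ^ K\<close> is
  absorbed into the coefficient \<open>c\<close>.\<close>

lemma power_sum_reward_ratio:
  "derivative_ratio_on {\<theta>. \<theta> > 0 \<or> (\<theta> \<noteq> 0 \<and> (\<forall>i\<in>{1..I}. j i \<in> \<int>))}
     (\<lambda>\<theta> x. f \<theta> * (\<Sum>i=1..I. a i * rpow \<theta> (j i) * rpow x (real K - j i)) + g \<theta> * x + h \<theta>)
     (ratio_at_1 (\<lambda>u. \<Sum>i=1..I. a i * u powr (real K - j i)))"
proof (rule derivative_ratio_onI[where S = "{0<..}" and U = "\<lambda>\<theta>. {x. 0 < x / \<theta>}"
      and c = "\<lambda>\<theta>. f \<theta> * \<theta> ^ K" and g = g and h = h])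
  show "times_differentiable_on 3 {0<..} (\<lambda>u. \<Sum>i=1..I. a i * u powr (real K - j i))"
    by (intro times_differentiable_on_sum times_differentiable_on_mult
        times_differentiable_on_const times_differentiable_on_powr)
next
  fix \<theta> :: real assume "\<theta> \<in> {\<theta>. \<theta> > 0 \<or> (\<theta> \<noteq> 0 \<and> (\<forall>i\<in>{1..I}. j i \<in> \<int>))}"
  then have "\<theta> \<noteq> 0" by auto
  then show "\<theta> \<noteq> 0 \<and> open {x. 0 < x / \<theta>} \<and> \<theta> \<in> {x. 0 < x / \<theta>}"
    by (auto intro!: open_Collect_less continuous_intros)
next
  fix \<theta> x :: real assume \<theta>: "\<theta> \<in> {\<theta>. \<theta> > 0 \<or> (\<theta> \<noteq> 0 \<and> (\<forall>i\<in>{1..I}. j i \<in> \<int>))}"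
    and x: "x \<in> {x. 0 < x / \<theta>}"
  have "a i * rpow \<theta> (j i) * rpow x (real K - j i)
      = \<theta> ^ K * (a i * (x / \<theta>) powr (real K - j i))" if "i \<in> {1..I}" for i
    using rpow_mult_rpow_diff[of \<theta> "j i" x K] \<theta> x that by auto
  then have "(\<Sum>i=1..I. a i * rpow \<theta> (j i) * rpow x (real K - j i))
      = \<theta> ^ K * (\<Sum>i=1..I. a i * (x / \<theta>) powr (real K - j i))"
    unfolding sum_distrib_left by (rule sum.cong[OF refl])
  then show "f \<theta> * (\<Sum>i=1..I. a i * rpow \<theta> (j i) * rpow x (real K - j i)) + g \<theta> * x + h \<theta>
      = f \<theta> * \<theta> ^ K * (\<Sum>i=1..I. a i * (x / \<theta>) powr (real K - j i)) + g \<theta> * x + h \<theta>"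
    by simp
qed auto

lemma exp_reward_ratio:
  "derivative_ratio_on {\<theta>. \<theta> \<noteq> 0} (\<lambda>\<theta> x. f \<theta> * exp (a * x / \<theta>)) (ratio_at_1 (\<lambda>u. exp (a * u)))"
proof (rule derivative_ratio_onI[where S = UNIV and U = "\<lambda>\<theta>. UNIV" and c = f
      and g = "\<lambda>\<theta>. 0" and h = "\<lambda>\<theta>. 0"])
  show "times_differentiable_on 3 UNIV (\<lambda>u. exp (a * u))"
    by (rule times_differentiable_on_compose[OF times_differentiable_on_exp[of _ UNIV]])
      (simp_all add: times_differentiable_on_mult times_differentiable_on_const
        times_differentiable_on_ident)
qed auto

text \<open>The offset \<open>b\<close> lets one rule serve both the explicit reward
  (\<open>b = 0\<close>) and the exponential objective (\<open>b = a\<close>, with coefficient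
  \<open>- 1\<close>).\<close>

lemma times_differentiable_on_inverse_exp:
  "times_differentiable_on n {0<..} (\<lambda>u. inverse u * exp (b + a * inverse u))"
  by (intro times_differentiable_on_mult times_differentiable_on_inverse
      times_differentiable_on_compose[OF times_differentiable_on_exp[of _ UNIV]]
      times_differentiable_on_add times_differentiable_on_const subset_UNIV)

lemma inverse_exp_reward_ratio:
  "derivative_ratio_on {\<theta>. \<theta> \<noteq> 0} (\<lambda>\<theta> x. f \<theta> / x * exp (a * \<theta> / x))
     (ratio_at_1 (\<lambda>u. inverse u * exp (0 + a * inverse u)))"
  \<comment> \<open>The representation holds for all \<open>x\<close>, including
    \<open>x = 0\<close>, where division by zero makes both sides 0.\<close>
  by (rule derivative_ratio_onI[where S = "{0<..}" and U = "\<lambda>\<theta>. UNIV" and c = "\<lambda>\<theta>. f \<theta> / \<theta>"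
        and g = "\<lambda>\<theta>. 0" and h = "\<lambda>\<theta>. 0"])
    (use times_differentiable_on_inverse_exp[of 3 0 a] in auto)

text \<open>Splitting the logarithm of
  \<open>g \<theta> * x = x / \<theta> * (g \<theta> * \<theta>)\<close> moves \<open>g\<close> into
  the constant term. The constant is \<open>2 / (- 1) = - 2\<close>.\<close>

lemma ln_reward_ratio:
  "derivative_ratio_on {\<theta>. g \<theta> * \<theta> > 0} (\<lambda>\<theta> x. f \<theta> * ln (g \<theta> * x) + x) (ratio_at_1 ln)"
proof (rule derivative_ratio_onI[where S = "{0<..}" and U = "\<lambda>\<theta>. {x. 0 < g \<theta> * x}" and c = f
      and g = "\<lambda>\<theta>. 1" and h = "\<lambda>\<theta>. f \<theta> * ln (g \<theta> * \<theta>)"])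
  fix \<theta> assume "\<theta> \<in> {\<theta>. g \<theta> * \<theta> > 0}"
  then show "\<theta> \<noteq> 0 \<and> open {x. 0 < g \<theta> * x} \<and> \<theta> \<in> {x. 0 < g \<theta> * x}"
    by (auto intro!: open_Collect_less continuous_intros)
next
  fix \<theta> x assume "\<theta> \<in> {\<theta>. g \<theta> * \<theta> > 0}" and x: "x \<in> {x. 0 < g \<theta> * x}"
  then have \<theta>: "g \<theta> * \<theta> > 0" "\<theta> \<noteq> 0" by auto
  have "0 < x / \<theta>" using \<theta> x by (auto simp: zero_less_mult_iff zero_less_divide_iff)
  then have "ln (x / \<theta> * (g \<theta> * \<theta>)) = ln (x / \<theta>) + ln (g \<theta> * \<theta>)"
    using \<theta> by (intro ln_mult_pos)
  moreover have "x / \<theta> * (g \<theta> * \<theta>) = g \<theta> * x"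
    using \<theta> by simp
  ultimately show "f \<theta> * ln (g \<theta> * x) + x = f \<theta> * ln (x / \<theta>) + 1 * x + f \<theta> * ln (g \<theta> * \<theta>)"
    by (metis (no_types) add.assoc add.commute distrib_left mult_1)
qed (auto intro: times_differentiable_on_ln)

section \<open>Surrogate rewards obtained from first-order conditions\<close>

text \<open>The derivative \<open>a\<^sub>1 * x / w - a\<^sub>2\<close> vanishes at
  \<open>w = a\<^sub>1 * x / a\<^sub>2\<close>. Inserting this gives a logarithm of the ratio plus
  an affine function of \<open>x\<close>, with the same \<phi> as for the explicit logarithmic
  reward.\<close>

lemma ln_objective_ratio:
  fixes a\<^sub>1 a\<^sub>2 :: real
  defines "F \<equiv> \<lambda>z \<theta>. a\<^sub>1 * \<theta> * ln z - a\<^sub>2 * z"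
  assumes "a\<^sub>2 > 0" "open D" "D \<subseteq> {\<theta>. a\<^sub>1 * \<theta> > 0}" "foc_decision F (\<lambda>x. {w. w > 0}) D z"
  shows "derivative_ratio_on D (surrogate F z) (ratio_at_1 ln)"
proof (rule derivative_ratio_onI[where S = "{0<..}" and U = "\<lambda>\<theta>. D" and c = "\<lambda>\<theta>. a\<^sub>1 * \<theta>"
      and g = "\<lambda>\<theta>. - a\<^sub>1" and h = "\<lambda>\<theta>. a\<^sub>1 * \<theta> * ln (a\<^sub>1 * \<theta> / a\<^sub>2)"])
  fix \<theta> x assume "\<theta> \<in> D" "x \<in> D"
  then have \<theta>: "a\<^sub>1 * \<theta> > 0" "\<theta> \<noteq> 0" and x: "a\<^sub>1 * x > 0" using assms(4) by auto
  have "((\<lambda>v. F v x) has_real_derivative 0) (at (a\<^sub>1 * x / a\<^sub>2))"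
    unfolding F_def using x assms(2) by (auto intro!: derivative_eq_intros)
  then have z: "z x = a\<^sub>1 * x / a\<^sub>2"
    using foc_decision_eq[OF assms(5) \<open>x \<in> D\<close>] x assms(2) by auto
  have "0 < x / \<theta>" using \<theta> x by (auto simp: zero_less_mult_iff zero_less_divide_iff)
  then have "ln (x / \<theta> * (a\<^sub>1 * \<theta> / a\<^sub>2)) = ln (x / \<theta>) + ln (a\<^sub>1 * \<theta> / a\<^sub>2)"
    using \<theta> assms(2) by (intro ln_mult_pos) auto
  moreover have "x / \<theta> * (a\<^sub>1 * \<theta> / a\<^sub>2) = a\<^sub>1 * x / a\<^sub>2"
    using \<theta> by simp
  ultimately have "ln (a\<^sub>1 * x / a\<^sub>2) = ln (x / \<theta>) + ln (a\<^sub>1 * \<theta> / a\<^sub>2)"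
    by metis
  then show "surrogate F z \<theta> x
      = a\<^sub>1 * \<theta> * ln (x / \<theta>) + - a\<^sub>1 * x + a\<^sub>1 * \<theta> * ln (a\<^sub>1 * \<theta> / a\<^sub>2)"
    using assms(2) by (simp add: surrogate_def F_def z algebra_simps)
qed (use assms in \<open>auto intro: times_differentiable_on_ln\<close>)

text \<open>With nonzero demand the condition reads \<open>a - x * w = \<gamma> * x * w\<close>, so
  \<open>w = k / x\<close>. With \<open>u = x / \<theta>\<close> the remaining demand
  \<open>a - \<theta> * w\<close> is \<open>a - k / u\<close>.\<close>

lemma powr_objective_ratio:
  fixes a \<gamma> :: real and f :: "real \<Rightarrow> real"
  defines "F \<equiv> \<lambda>z \<theta>. f \<theta> * z * (a - \<theta> * z) powr \<gamma>" and "k \<equiv> a / (1 + \<gamma>)"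
  assumes "a > 0" "\<gamma> > 0" "open D" "D \<subseteq> {\<theta>. \<theta> > 0}"
    and "foc_decision F (\<lambda>x. {w. a - x * w > 0}) D z"
  shows "derivative_ratio_on D (surrogate F z)
    (ratio_at_1 (\<lambda>u. inverse u * (a + - k * inverse u) powr \<gamma>))"
proof -
  have k: "0 < k" "k < a" "a - k = \<gamma> * k"
    using assms(3,4) by (auto simp: k_def field_simps)
  show ?thesis
  \<comment> \<open>The base \<open>a - k / u\<close> of the power is positive exactly for
    \<open>u > k / a\<close> among positive \<open>u\<close>; the point 1 qualifies because
    \<open>k < a\<close>.\<close>
  proof (rule derivative_ratio_onI[where S = "{k / a<..}" and U = "\<lambda>\<theta>. D"
        and c = "\<lambda>\<theta>. f \<theta> * k / \<theta>" and g = "\<lambda>\<theta>. 0" and h = "\<lambda>\<theta>. 0"])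
    have pos: "0 < u" if "k / a < u" for u
      using that k assms(3) by (meson divide_pos_pos less_trans)
    \<comment> \<open>Composition with the identity restricts the rule for \<open>inverse\<close> to
      the smaller half-line.\<close>
    have inv: "times_differentiable_on 3 {k / a<..} inverse"
      by (rule times_differentiable_on_compose[OF times_differentiable_on_inverse
            times_differentiable_on_ident]) (use pos in blast)
    have "0 < a + - k * inverse u" if "k / a < u" for u
      using that pos[OF that] assms(3) by (simp add: field_simps)
    then have "times_differentiable_on 3 {k / a<..} (\<lambda>u. (a + - k * inverse u) powr \<gamma>)"
      by (intro times_differentiable_on_compose[OF times_differentiable_on_powr]
          times_differentiable_on_add times_differentiable_on_const times_differentiable_on_mult inv)
        auto
    with inv show "times_differentiable_on 3 {k / a<..}
        (\<lambda>u. inverse u * (a + - k * inverse u) powr \<gamma>)"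
      by (rule times_differentiable_on_mult)
  next
    fix \<theta> x assume "\<theta> \<in> D" "x \<in> D"
    then have \<theta>: "\<theta> > 0" and x: "x > 0" using assms(6) by auto
    \<comment> \<open>One factor \<open>a - k = \<gamma> * k\<close> is split off the power, so the
      two terms of the derivative at \<open>k / x\<close> cancel.\<close>
    have "(a - k) powr \<gamma> = (a - k) * (a - k) powr (\<gamma> - 1)"
      using k powr_add[of "a - k" 1 "\<gamma> - 1"] by simp
    then have foc: "(a - k) powr \<gamma> - \<gamma> * k * (a - k) powr (\<gamma> - 1) = 0"
      by (simp add: k(3))
    have "((\<lambda>v. F v x) has_real_derivative
        f x * ((a - k) powr \<gamma> - \<gamma> * k * (a - k) powr (\<gamma> - 1))) (at (k / x))"
      unfolding F_def using x k
      by (auto intro!: derivative_eq_intros simp: powr_diff field_simps)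
    then have "((\<lambda>v. F v x) has_real_derivative 0) (at (k / x))"
      by (simp only: foc mult_zero_right)
    then have "z x = k / x"
      using foc_decision_eq[OF assms(7) \<open>x \<in> D\<close>] x k by auto
    then show "surrogate F z \<theta> x
        = f \<theta> * k / \<theta> * (inverse (x / \<theta>) * (a + - k * inverse (x / \<theta>)) powr \<gamma>) + 0 * x + 0"
      using x \<theta> by (simp add: surrogate_def F_def mult.commute)
  qed (use assms(3,5,6) k in auto)
qed

text \<open>The derivative \<open>f x * exp (a - x * w) * (1 - x * w)\<close> vanishes at
  \<open>w = 1 / x\<close>, and \<open>\<theta> * w\<close> is then the inverse of the
  ratio.\<close>

lemma exp_objective_ratio:
  fixes a :: real and f :: "real \<Rightarrow> real"
  defines "F \<equiv> \<lambda>z \<theta>. f \<theta> * z * exp (a - \<theta> * z)"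
  assumes "open D" "D \<subseteq> {\<theta>. \<theta> > 0}" "foc_decision F (\<lambda>x. UNIV) D z"
  shows "derivative_ratio_on D (surrogate F z)
    (ratio_at_1 (\<lambda>u. inverse u * exp (a + - 1 * inverse u)))"
proof (rule derivative_ratio_onI[where S = "{0<..}" and U = "\<lambda>\<theta>. D" and c = "\<lambda>\<theta>. f \<theta> / \<theta>"
      and g = "\<lambda>\<theta>. 0" and h = "\<lambda>\<theta>. 0"])
  fix \<theta> x assume "\<theta> \<in> D" "x \<in> D"
  then have \<theta>: "\<theta> > 0" and x: "x > 0" using assms(3) by auto
  have "((\<lambda>v. F v x) has_real_derivative 0) (at (1 / x))"
    unfolding F_def using x by (auto intro!: derivative_eq_intros)
  then have "z x = 1 / x"
    using foc_decision_eq[OF assms(4) \<open>x \<in> D\<close>] by auto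
  then show "surrogate F z \<theta> x
      = f \<theta> / \<theta> * (inverse (x / \<theta>) * exp (a + - 1 * inverse (x / \<theta>))) + 0 * x + 0"
    using x \<theta> by (simp add: surrogate_def F_def)
next
  show "times_differentiable_on 3 {0<..} (\<lambda>u. inverse u * exp (a + - 1 * inverse u))"
    by (rule times_differentiable_on_inverse_exp)
qed (use assms(2,3) in auto)

section \<open>Assembly of the seven cases\<close>

theorem proposition1:
  shows
    "(\<forall>(I::nat) (K::nat) (a::nat \<Rightarrow> real) (j::nat \<Rightarrow> real).
        \<exists>C::real. \<forall>(f::real \<Rightarrow> real) (g::real \<Rightarrow> real) (h::real \<Rightarrow> real).
          derivative_ratio_on {\<theta>. \<theta> > 0 \<or> (\<theta> \<noteq> 0 \<and> (\<forall>i\<in>{1..I}. j i \<in> \<int>))}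
            (\<lambda>\<theta> x. f \<theta> * (\<Sum>i=1..I. a i * rpow \<theta> (j i) * rpow x (real K - j i)) + g \<theta> * x + h \<theta>)
            C)
   \<and> (\<forall>a::real. \<exists>C::real. \<forall>f::real \<Rightarrow> real.
        derivative_ratio_on {\<theta>. \<theta> \<noteq> 0} (\<lambda>\<theta> x. f \<theta> * exp (a * x / \<theta>)) C)
   \<and> (\<forall>a::real. \<exists>C::real. \<forall>f::real \<Rightarrow> real.
        derivative_ratio_on {\<theta>. \<theta> \<noteq> 0} (\<lambda>\<theta> x. f \<theta> / x * exp (a * \<theta> / x)) C)
   \<and> (\<exists>C::real. \<forall>(f::real \<Rightarrow> real) (g::real \<Rightarrow> real).
        derivative_ratio_on {\<theta>. g \<theta> * \<theta> > 0} (\<lambda>\<theta> x. f \<theta> * ln (g \<theta> * x) + x) C)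
   \<and> (\<forall>(a\<^sub>1::real) (a\<^sub>2::real). a\<^sub>2 > 0 \<longrightarrow>
        (\<exists>C::real.
          let F = (\<lambda>z \<theta>. a\<^sub>1 * \<theta> * ln z - a\<^sub>2 * z) in
          \<forall>D z. open D \<and> D \<subseteq> {\<theta>. a\<^sub>1 * \<theta> > 0} \<and> foc_decision F (\<lambda>x. {w. w > 0}) D z \<longrightarrow>
            derivative_ratio_on D (surrogate F z) C))
   \<and> (\<forall>(a::real) (\<gamma>::real). a > 0 \<and> \<gamma> > 0 \<longrightarrow>
        (\<exists>C::real. \<forall>f::real \<Rightarrow> real \<Rightarrow> real \<Rightarrow> real.
          let F = (\<lambda>z \<theta>. f a \<theta> \<gamma> * z * (a - \<theta> * z) powr \<gamma>) in
          \<forall>D z. open D \<and> D \<subseteq> {\<theta>. \<theta> > 0} \<and> foc_decision F (\<lambda>x. {w. a - x * w > 0}) D z \<longrightarrow>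
            derivative_ratio_on D (surrogate F z) C))
   \<and> (\<forall>a::real. a > 0 \<longrightarrow>
        (\<exists>C::real. \<forall>f::real \<Rightarrow> real \<Rightarrow> real.
          let F = (\<lambda>z \<theta>. f a \<theta> * z * exp (a - \<theta> * z)) in
          \<forall>D z. open D \<and> D \<subseteq> {\<theta>. \<theta> > 0} \<and> foc_decision F (\<lambda>x. UNIV) D z \<longrightarrow>
            derivative_ratio_on D (surrogate F z) C))"
  unfolding Let_def
  apply (intro conjI)
        \<comment> \<open>In each case the schematic witness for \<open>C\<close> is fixed by
          unification with \<open>ratio_at_1 \<phi>\<close>. This is possible because \<phi>
          mentions only the constants quantified before \<open>C\<close>, not the functions,
          \<open>D\<close> or \<open>z\<close> quantified after it.\<close>
        apply (intro allI exI, rule power_sum_reward_ratio)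
       apply (intro allI exI, rule exp_reward_ratio)
      apply (intro allI exI, rule inverse_exp_reward_ratio)
     apply (intro allI exI, rule ln_reward_ratio)
    apply (intro allI impI exI, elim conjE, rule ln_objective_ratio; assumption)
   apply (intro allI impI exI, elim conjE, rule powr_objective_ratio; assumption)
  apply (intro allI impI exI, elim conjE, rule exp_objective_ratio; assumption)
  done

end
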